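(* Let $\alpha,\beta>-1$ with $\alpha-\beta>-1$, let $P^{(\alpha,\beta)}_{n,k}$ be the Laguerre-Laguerre Koornwinder polynomials, and let $\langle f,g\rangle=\int_{0}^{\infty}\int_{0}^{\infty}f(x,y)g(x,y)\,x^{\alpha-\beta}y^{\beta}e^{-(x+y/x)}\,dx\,dy$. Let $n,m\in\mathbb{N}_0$ and $0\leq j\leq m$. If $k\geq 0$ and $n\geq k+1$, then $$\Big\langle P_{m,j}^{(\alpha,\beta)},\frac{\partial}{\partial\alpha}P_{n,k}^{(\alpha,\beta)}\Big\rangle=\begin{cases}0, & k\neq j,\\ 0, & k=j,\ m\geq n,\\ H_{n,k,m}^{(\alpha,\beta)}, & n>m\geq k=j,\end{cases}$$ and if $n=k\geq 0$, then $\Big\langle P_{m,j}^{(\alpha,\beta)},\frac{\partial}{\partial\alpha}P_{n,n}^{(\alpha,\beta)}\Big\rangle=0$, where $$H_{n,k,m}^{(\alpha,\beta)}=\frac{1}{n-m}\,t_{m,k}^{(\alpha,\beta)},\qquad t_{n,k}^{(\alpha,\beta)}=\frac{\Gamma(\beta+k+1)\,\Gamma(\alpha+n+k+2)}{k!\,(n-k)!}.$$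
   Context: The generalized Laguerre polynomials are $L_{n}^{(a)}(x)=\frac{x^{-a}e^{x}}{n!}\frac{d^{n}}{dx^{n}}\{e^{-x}x^{n+a}\}$. For $\alpha,\beta>-1$ with $\alpha-\beta>-1$ and integers $0\le k\le n$, the Laguerre-Laguerre Koornwinder polynomials are $$P^{(\alpha,\beta)}_{n,k}(x,y)=L^{(\alpha+2k+1)}_{n-k}(x)\,x^{k}\,L^{(\beta)}_{k}\!\left(\frac{y}{x}\right).$$ The derivative $\partial/\partial\alpha$ is taken with $\beta,x,y$ fixed (and the weight is not differentiated). *)

theory Defs
  imports "HOL-Analysis.Analysis"
begin

(* Rodrigues' formula. As in the formula itself, the argument x is meant to be positive: powr is not
   the intended power for x <= 0, and there the value is not that of the polynomial. *)
definition laguerre :: "nat \<Rightarrow> real \<Rightarrow> real \<Rightarrow> real" where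
  "laguerre n a x =
     x powr (- a) * exp x / fact n * (deriv ^^ n) (\<lambda>t. exp (- t) * t powr (real n + a)) x"

(* Meant for k <= n (the subtraction n - k is on nat) and x, y > 0. *)
definition koornwinder :: "nat \<Rightarrow> nat \<Rightarrow> real \<Rightarrow> real \<Rightarrow> real \<Rightarrow> real \<Rightarrow> real" where
  "koornwinder n k \<alpha> \<beta> x y =
     laguerre (n - k) (\<alpha> + 2 * real k + 1) x * x ^ k * laguerre k \<beta> (y / x)"

definition koornwinder_dalpha :: "nat \<Rightarrow> nat \<Rightarrow> real \<Rightarrow> real \<Rightarrow> real \<Rightarrow> real \<Rightarrow> real" where
  "koornwinder_dalpha n k \<alpha> \<beta> x y = deriv (\<lambda>a. koornwinder n k a \<beta> x y) \<alpha>"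

definition quadrant :: "(real \<times> real) set" where
  "quadrant = {0<..} \<times> {0<..}"

definition weight :: "real \<Rightarrow> real \<Rightarrow> real \<Rightarrow> real \<Rightarrow> real" where
  "weight \<alpha> \<beta> x y = x powr (\<alpha> - \<beta>) * y powr \<beta> * exp (- (x + y / x))"

(* The double integral is a Lebesgue integral over the plane. It is 0 by convention when the
   integrand is not integrable, so integrability has to be claimed separately. *)
definition ip_integrable ::
  "real \<Rightarrow> real \<Rightarrow> (real \<Rightarrow> real \<Rightarrow> real) \<Rightarrow> (real \<Rightarrow> real \<Rightarrow> real) \<Rightarrow> bool" where
  "ip_integrable \<alpha> \<beta> f g \<longleftrightarrow>
     set_integrable lborel quadrant (\<lambda>(x, y). f x y * g x y * weight \<alpha> \<beta> x y)"

definition ip :: "real \<Rightarrow> real \<Rightarrow> (real \<Rightarrow> real \<Rightarrow> real) \<Rightarrow> (real \<Rightarrow> real \<Rightarrow> real) \<Rightarrow> real" where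
  "ip \<alpha> \<beta> f g =
     set_lebesgue_integral lborel quadrant (\<lambda>(x, y). f x y * g x y * weight \<alpha> \<beta> x y)"

definition t_coeff :: "nat \<Rightarrow> nat \<Rightarrow> real \<Rightarrow> real \<Rightarrow> real" where
  "t_coeff n k \<alpha> \<beta> =
     Gamma (\<beta> + real k + 1) * Gamma (\<alpha> + real n + real k + 2) / (fact k * fact (n - k))"

definition H_coeff :: "nat \<Rightarrow> nat \<Rightarrow> nat \<Rightarrow> real \<Rightarrow> real \<Rightarrow> real" where
  "H_coeff n k m \<alpha> \<beta> = 1 / (real n - real m) * t_coeff m k \<alpha> \<beta>"

end

theory Submission imports Defs begin

text \<open>
  Write \<open>L n a\<close> for the Laguerre polynomial of degree \<open>n\<close> with parameter \<open>a\<close>. Substituting \<open>y = x u\<close> separates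
  the inner product into two one-dimensional Laguerre inner products (\<open>ip_separated\<close>). One factor is the
  integral of \<open>L j \<beta> * L k \<beta>\<close> against \<open>u powr \<beta> * exp (- u)\<close>, which vanishes unless \<open>j = k\<close>. The other
  carries the weight \<open>x powr (\<alpha> + 1) * exp (- x)\<close>: the exponents \<open>\<alpha> - \<beta>\<close> and \<open>\<beta>\<close> add up, and the Jacobian
  contributes one more. For \<open>j = k\<close> the powers \<open>x ^ k\<close> of the two Koornwinder polynomials raise its exponent to
  \<open>a = \<alpha> + 2 k + 1\<close>, exactly the parameter of the Laguerre polynomials in \<open>x\<close>. So this factor is the
  integral of \<open>L (m - k) a\<close> times the derivative of \<open>L (n - k) a\<close> with respect to \<open>a\<close>, against
  \<open>x powr a * exp (- x)\<close>.

  That derivative is a combination of lower Laguerre polynomials with the same parameter: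
  the derivative of \<open>L n a\<close> with respect to \<open>a\<close> is the sum over \<open>i < n\<close> of \<open>L i a / (n - i)\<close>
  (\<open>DERIV_laguerre_poly_parameter\<close>). By orthogonality (\<open>laguerre_poly_orthogonal\<close>) only the
  term \<open>L (m - k) a\<close> of the sum survives. It is present exactly when \<open>m < n\<close>, and it carries the
  factor \<open>1 / (n - m)\<close>; the squared norms of \<open>L (m - k) a\<close> and \<open>L k \<beta>\<close> supply the
  Gamma values and factorials. For \<open>n = k\<close> the sum is empty.

  Both ingredients are obtained algebraically. The derivative is read off from the addition formula
  \<open>laguerre_poly_add\<close>, a form of the Chu-Vandermonde identity. Orthogonality is repeated integration by
  parts (\<open>gamma_moment_mult_laguerre_poly\<close>); in terms of moments, integration by parts is just the functional
  equation of the Gamma function (\<open>gamma_moment_pderiv\<close>), so there are no boundary terms to estimate.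
\<close>

section \<open>Laguerre polynomials and Rodrigues' formula\<close>

definition laguerre_poly :: "nat \<Rightarrow> real \<Rightarrow> real poly" where
  "laguerre_poly n a = (\<Sum>i\<le>n. monom ((-1) ^ i / fact i * ((real n + a) gchoose (n - i))) i)"

lemma coeff_laguerre_poly: "coeff (laguerre_poly n a) i =
    (if i \<le> n then (-1) ^ i / fact i * ((real n + a) gchoose (n - i)) else 0)"
  by (simp add: laguerre_poly_def coeff_sum)

lemma laguerre_poly_0 [simp]: "laguerre_poly 0 a = 1"
  by (simp add: laguerre_poly_def)

text \<open>This is one differentiation in Rodrigues' formula, with the factor \<open>exp (- x) * x powr a\<close> cancelled.
  It drives both the passage from Rodrigues' formula to the explicit polynomial and the integration
  by parts in \<open>gamma_moment_mult_laguerre_poly\<close>.\<close>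

lemma laguerre_poly_Suc:
  "smult (real (Suc n)) (laguerre_poly (Suc n) a) =
     smult (a + 1) (laguerre_poly n (a + 1))
       + pCons 0 (pderiv (laguerre_poly n (a + 1)) - laguerre_poly n (a + 1))"
proof (rule poly_eqI)
  fix i
  define N where "N = real (Suc n) + a"
  have N: "real n + (a + 1) = N" "real (Suc n) + a = N" by (simp_all add: N_def)
  \<comment> \<open>Both sides of the recurrence involve binomial coefficients with the same upper entry \<open>N\<close>;
    neighbouring ones are related by absorption.\<close>
  have step: "(real (Suc n) - real i) * (N gchoose (Suc n - i)) = (a + 1 + real i) * (N gchoose (n - i))"
    if "i \<le> n" for i
    using gbinomial_mult_1[of N "n - i"] that
    by (simp add: Suc_diff_le N_def algebra_simps of_nat_diff)
  show "coeff (smult (real (Suc n)) (laguerre_poly (Suc n) a)) i =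
     coeff (smult (a + 1) (laguerre_poly n (a + 1))
       + pCons 0 (pderiv (laguerre_poly n (a + 1)) - laguerre_poly n (a + 1))) i"
  proof (cases i)
    case 0
    then show ?thesis
      using step[of 0] by (simp add: coeff_laguerre_poly N del: of_nat_Suc)
  next
    case (Suc l)
    consider "i \<le> n" | "i = Suc n" | "i > Suc n" by linarith
    then show ?thesis
    proof cases
      case 1
      define e G G' :: real where "e = (-1) ^ i / fact i"
        and "G = (N gchoose (n - l))" and "G' = (N gchoose (n - i))"
      have fi: "fact i = real i * fact l" "(-1) ^ i = - ((-1) ^ l :: real)" "real i \<noteq> 0"
        by (simp_all add: Suc)
      have e: "(-1) ^ l / fact l = - real i * e"
        using fi(3) by (simp add: e_def fi(1,2))
      have c: "coeff (laguerre_poly n (a + 1)) i = e * G'"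
        "coeff (laguerre_poly n (a + 1)) l = - real i * e * G"
        unfolding e[symmetric] using 1 Suc
        by (simp_all add: coeff_laguerre_poly N e_def G_def G'_def del: fact_Suc power_Suc)
      have "coeff (smult (a + 1) (laguerre_poly n (a + 1))
          + pCons 0 (pderiv (laguerre_poly n (a + 1)) - laguerre_poly n (a + 1))) i
        = (a + 1) * coeff (laguerre_poly n (a + 1)) i
          + (real i * coeff (laguerre_poly n (a + 1)) i - coeff (laguerre_poly n (a + 1)) l)"
        by (simp add: Suc coeff_pderiv)
      also have "\<dots> = e * ((a + 1 + real i) * G' + real i * G)"
        unfolding c by (simp add: algebra_simps)
      also have "(a + 1 + real i) * G' + real i * G = real (Suc n) * G"
        using step[OF 1] by (simp add: Suc G_def G'_def algebra_simps)
      finally show ?thesis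
        using 1 Suc by (simp add: coeff_laguerre_poly N e_def G_def del: of_nat_Suc)
    next
      case 2
      with Suc show ?thesis by (simp add: coeff_laguerre_poly coeff_pderiv N del: of_nat_Suc)
    next
      case 3
      with Suc show ?thesis by (simp add: coeff_laguerre_poly coeff_pderiv)
    qed
  qed
qed

text \<open>The parameter of the polynomial drops by one with each differentiation, because the exponent of \<open>x\<close> does;
  keeping \<open>b\<close> fixed while \<open>m\<close> grows is what makes the induction work.\<close>

lemma deriv_funpow_exp_powr:
  fixes x b :: real
  assumes "x > 0"
  shows "(deriv ^^ m) (\<lambda>t. exp (- t) * t powr b) x =
    exp (- x) * fact m * x powr (b - real m) * poly (laguerre_poly m (b - real m)) x"
  using assms
proof (induction m arbitrary: x)
  case (Suc m)
  define a L where "a = b - real (Suc m)" and "L = laguerre_poly m (a + 1)"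
  have a1: "b - real m = a + 1" by (simp add: a_def)
  have "(deriv ^^ Suc m) (\<lambda>t. exp (- t) * t powr b) x =
    deriv (\<lambda>t. exp (- t) * fact m * t powr (a + 1) * poly L t) x"
    unfolding funpow.simps o_def
  proof (rule deriv_cong_ev)
    show "\<forall>\<^sub>F t in nhds x. (deriv ^^ m) (\<lambda>t. exp (- t) * t powr b) t =
      exp (- t) * fact m * t powr (a + 1) * poly L t"
      using eventually_nhds_in_open[of "{0<..}" x] Suc.prems
      by (auto elim!: eventually_mono simp: Suc.IH a1 L_def)
  qed simp
  also have "\<dots> = exp (- x) * fact m * x powr a * ((a + 1) * poly L x + x * (poly (pderiv L) x - poly L x))"
  proof (rule DERIV_imp_deriv)
    have "((\<lambda>t. t powr (a + 1)) has_real_derivative (a + 1) * x powr a) (at x)"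
      using has_real_derivative_powr[of x "a + 1"] Suc.prems by simp
    moreover have "((\<lambda>t. exp (- t) * fact m) has_real_derivative - exp (- x) * fact m) (at x)"
      by (auto intro!: derivative_eq_intros)
    ultimately have "((\<lambda>t. exp (- t) * fact m * t powr (a + 1) * poly L t) has_real_derivative
        (- exp (- x) * fact m * x powr (a + 1) + (a + 1) * x powr a * (exp (- x) * fact m)) * poly L x
        + poly (pderiv L) x * (exp (- x) * fact m * x powr (a + 1))) (at x)"
      by (intro DERIV_mult poly_DERIV)
    then show "((\<lambda>t. exp (- t) * fact m * t powr (a + 1) * poly L t) has_real_derivative
        exp (- x) * fact m * x powr a * ((a + 1) * poly L x + x * (poly (pderiv L) x - poly L x))) (at x)"
      using Suc.prems by (simp add: powr_add algebra_simps)
  qed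
  also have "(a + 1) * poly L x + x * (poly (pderiv L) x - poly L x) =
      real (Suc m) * poly (laguerre_poly (Suc m) a) x"
    using arg_cong[OF laguerre_poly_Suc[of m a], of "\<lambda>p. poly p x"] by (simp add: L_def)
  finally show ?case by (simp add: a_def[symmetric] del: of_nat_Suc)
qed simp

lemma laguerre_eq_poly:
  assumes "x > 0"
  shows "laguerre n a x = poly (laguerre_poly n a) x"
proof -
  have "laguerre n a x = (x powr (- a) * x powr a) * (exp x * exp (- x)) * poly (laguerre_poly n a) x"
    using deriv_funpow_exp_powr[OF assms, of n "real n + a"] by (simp add: laguerre_def)
  then show ?thesis
    using assms by (simp add: powr_minus exp_minus)
qed

section \<open>Differentiation with respect to the parameter\<close>

lemma pochhammer_add_fact:
  fixes a b :: "'a :: field_char_0"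
  shows "pochhammer (a + b) n / fact n =
    (\<Sum>k\<le>n. pochhammer a k / fact k * (pochhammer b (n - k) / fact (n - k)))"
  unfolding pochhammer_binomial_sum sum_divide_distrib
  by (rule sum.cong) (simp_all add: binomial_fact)

text \<open>Comparing coefficients of each power of the variable reduces this to the Chu-Vandermonde identity in the form
  \<open>pochhammer_add_fact\<close>. Its purpose is that all dependence on the increment \<open>h\<close> sits in scalar
  factors.\<close>

lemma laguerre_poly_add:
  "laguerre_poly n (a + h) = (\<Sum>i\<le>n. smult (pochhammer h (n - i) / fact (n - i)) (laguerre_poly i a))"
proof (rule poly_eqI)
  fix l
  have c: "coeff (laguerre_poly i b) l =
    (if l \<le> i then (-1) ^ l / fact l * (pochhammer (b + real l + 1) (i - l) / fact (i - l)) else 0)" for i b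
    by (auto simp: coeff_laguerre_poly gbinomial_pochhammer' of_nat_diff algebra_simps)
  show "coeff (laguerre_poly n (a + h)) l =
    coeff (\<Sum>i\<le>n. smult (pochhammer h (n - i) / fact (n - i)) (laguerre_poly i a)) l"
  proof (cases "l \<le> n")
    case True
    have "coeff (laguerre_poly n (a + h)) l =
      (\<Sum>k\<le>n - l. (-1) ^ l / fact l * (pochhammer (a + real l + 1) k / fact k *
         (pochhammer h (n - l - k) / fact (n - l - k))))"
      using True pochhammer_add_fact[of "a + real l + 1" h "n - l"]
      by (simp add: c sum_distrib_left add_ac)
    also have "\<dots> = (\<Sum>i\<in>{l..n}. coeff (laguerre_poly i a) l * (pochhammer h (n - i) / fact (n - i)))"
      by (rule sum.reindex_bij_witness[of _ "\<lambda>i. i - l" "\<lambda>k. k + l"])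
         (use True in \<open>auto simp: c add_ac\<close>)
    also have "\<dots> = (\<Sum>i\<le>n. coeff (laguerre_poly i a) l * (pochhammer h (n - i) / fact (n - i)))"
      by (rule sum.mono_neutral_left) (auto simp: coeff_laguerre_poly)
    finally show ?thesis by (simp add: coeff_sum mult.commute)
  qed (simp add: coeff_sum coeff_laguerre_poly)
qed

text \<open>The factor \<open>h\<close> of the rising factorial vanishes at 0, so the derivative is the value
  of the remaining factors there.\<close>

lemma DERIV_pochhammer_0:
  assumes "s > 0"
  shows "((\<lambda>h::real. pochhammer h s) has_field_derivative fact (s - 1)) (at 0)"
proof -
  obtain r where s: "s = Suc r" using assms by (cases s) auto
  have "isCont (\<lambda>h::real. pochhammer (h + 1) r) 0"
    by (rule isCont_o2[OF _ isCont_pochhammer]) simp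
  then show ?thesis
    unfolding CARAT_DERIV
    by (intro exI[of _ "\<lambda>h. pochhammer (h + 1) r"]) (simp add: s pochhammer_rec pochhammer_fact[symmetric])
qed

text \<open>The derivative of \<open>laguerre_poly n a\<close> with respect to \<open>a\<close>, already expanded in the orthogonal basis that makes
  its moments computable.\<close>

definition laguerre_poly_dparam :: "nat \<Rightarrow> real \<Rightarrow> real poly" where
  "laguerre_poly_dparam n a = (\<Sum>i<n. smult (1 / (real n - real i)) (laguerre_poly i a))"

text \<open>Differentiate the addition formula at \<open>h = 0\<close>: the term with \<open>i = n\<close> is constant in \<open>h\<close>, and for \<open>i < n\<close>
  the scalar has derivative \<open>fact (n - i - 1) / fact (n - i)\<close>, that is, \<open>1 / (n - i)\<close>.\<close>

lemma DERIV_laguerre_poly_parameter: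
  "((\<lambda>b. poly (laguerre_poly n b) x) has_field_derivative poly (laguerre_poly_dparam n a) x) (at a)"
proof -
  have D: "((\<lambda>h. pochhammer h (n - i) / fact (n - i) * poly (laguerre_poly i a) x) has_field_derivative
        (if i < n then 1 / (real n - real i) * poly (laguerre_poly i a) x else 0)) (at 0)" if "i \<le> n" for i
  proof (cases "i < n")
    case True
    then obtain s where s: "n - i = Suc s" "real n - real i = real (Suc s)"
      by (metis Suc_diff_Suc of_nat_diff less_imp_le)
    show ?thesis using True DERIV_pochhammer_0[of "n - i"] unfolding s
      by (auto intro!: derivative_eq_intros simp: s)
  qed (use that in simp)
  have "((\<lambda>h. \<Sum>i\<le>n. pochhammer h (n - i) / fact (n - i) * poly (laguerre_poly i a) x) has_field_derivative
        (\<Sum>i\<le>n. if i < n then 1 / (real n - real i) * poly (laguerre_poly i a) x else 0)) (at 0)"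
    by (rule DERIV_sum) (use D in auto)
  also have "(\<Sum>i\<le>n. if i < n then 1 / (real n - real i) * poly (laguerre_poly i a) x else 0) =
      poly (laguerre_poly_dparam n a) x"
    unfolding laguerre_poly_dparam_def poly_sum poly_smult by (rule sum.mono_neutral_cong_right) auto
  also have "(\<lambda>h. \<Sum>i\<le>n. pochhammer h (n - i) / fact (n - i) * poly (laguerre_poly i a) x) =
      (\<lambda>h. poly (laguerre_poly n (h + a)) x)"
    by (simp add: add.commute[of _ a] laguerre_poly_add poly_sum)
  finally show ?thesis
    using DERIV_shift[of "\<lambda>b. poly (laguerre_poly n b) x" _ 0 a] by simp
qed

section \<open>Moments of the Gamma weight and orthogonality\<close>

definition gamma_weight :: "real \<Rightarrow> real \<Rightarrow> real" where
  "gamma_weight a x = indicator {0<..} x * (x powr a * exp (- x))"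

lemma gamma_weight_measurable [measurable]: "gamma_weight a \<in> borel_measurable borel"
  unfolding gamma_weight_def by measurable

lemma gamma_weight_mult: "x * gamma_weight a x = gamma_weight (a + 1) x"
  by (auto simp: gamma_weight_def powr_add indicator_def)

lemma has_bochner_integral_gamma_weight:
  assumes "a > -1"
  shows "has_bochner_integral lborel (gamma_weight a) (Gamma (a + 1))"
proof (rule has_bochner_integral_nn_integral)
  have "(\<integral>\<^sup>+x. ennreal (gamma_weight a x) \<partial>lborel) =
      (\<integral>\<^sup>+x. ennreal (indicator {0..} x * x powr (a + 1 - 1) / exp x) \<partial>lborel)"
    by (rule nn_integral_cong)
       (auto simp: gamma_weight_def indicator_def exp_minus divide_inverse)
  also have "\<dots> = ennreal (Gamma (a + 1))"
    using Gamma_conv_nn_integral_real[of "a + 1"] assms by simp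
  finally show "(\<integral>\<^sup>+x. ennreal (gamma_weight a x) \<partial>lborel) = ennreal (Gamma (a + 1))" .
  show "0 \<le> Gamma (a + 1)" using assms Gamma_real_pos[of "a + 1"] by simp
qed (auto simp: gamma_weight_def)

definition gamma_moment :: "real \<Rightarrow> real poly \<Rightarrow> real" where
  "gamma_moment a p = (\<integral>x. poly p x * gamma_weight a x \<partial>lborel)"

lemma integrable_poly_gamma_weight:
  "a > -1 \<Longrightarrow> integrable lborel (\<lambda>x. poly p x * gamma_weight a x)"
proof (induction p arbitrary: a)
  case (pCons c p)
  have "poly (pCons c p) x * gamma_weight a x = c * gamma_weight a x + poly p x * gamma_weight (a + 1) x" for x
    by (simp add: gamma_weight_mult[symmetric] distrib_left distrib_right mult_ac)
  then show ?case
    using pCons.IH[of "a + 1"] pCons.prems has_bochner_integral_gamma_weight[of a]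
    by (auto simp: has_bochner_integral_iff)
qed simp

text \<open>Multiplying by the variable raises the exponent of the weight by one. This recursion determines all moments,
  so the moment identities below follow by induction over the polynomial, for all exponents at once.\<close>

lemma gamma_moment_pCons:
  assumes "a > -1"
  shows "gamma_moment a (pCons c p) = c * Gamma (a + 1) + gamma_moment (a + 1) p"
proof -
  have "poly (pCons c p) x * gamma_weight a x = c * gamma_weight a x + poly p x * gamma_weight (a + 1) x" for x
    by (simp add: gamma_weight_mult[symmetric] distrib_left distrib_right mult_ac)
  then show ?thesis
    using integrable_poly_gamma_weight[of "a + 1" p] assms has_bochner_integral_gamma_weight[of a]
    by (auto simp: gamma_moment_def has_bochner_integral_iff)
qed

lemma gamma_moment_0 [simp]: "gamma_moment a 0 = 0"
  by (simp add: gamma_moment_def)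

lemma gamma_moment_add: "a > -1 \<Longrightarrow> gamma_moment a (p + q) = gamma_moment a p + gamma_moment a q"
  using integrable_poly_gamma_weight[of a] by (simp add: gamma_moment_def distrib_right)

lemma gamma_moment_diff: "a > -1 \<Longrightarrow> gamma_moment a (p - q) = gamma_moment a p - gamma_moment a q"
  using integrable_poly_gamma_weight[of a] by (simp add: gamma_moment_def left_diff_distrib)

lemma gamma_moment_smult: "gamma_moment a (smult c p) = c * gamma_moment a p"
  by (simp add: gamma_moment_def mult.assoc)

lemma gamma_moment_sum:
  "a > -1 \<Longrightarrow> gamma_moment a (\<Sum>i\<in>A. f i) = (\<Sum>i\<in>A. gamma_moment a (f i))"
  by (induction A rule: infinite_finite_induct) (simp_all add: gamma_moment_add)

lemma gamma_moment_monom_mult: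
  "a > -1 \<Longrightarrow> gamma_moment a (monom 1 k * p) = gamma_moment (a + real k) p"
  by (induction k arbitrary: a) (simp_all add: monom_Suc gamma_moment_pCons monom_0 add_ac)

text \<open>Integration by parts for the weight \<open>x powr (a + 1) * exp (- x)\<close>. On constants it is
  \<open>Gamma (a + 2) = (a + 1) * Gamma (a + 1)\<close>; multiplying by the variable only shifts \<open>a\<close>, which gives the induction.\<close>

lemma gamma_moment_pderiv:
  assumes "a > -1"
  shows "gamma_moment (a + 1) (pderiv p) = gamma_moment (a + 1) p - (a + 1) * gamma_moment a p"
  using assms
proof (induction p arbitrary: a)
  case (pCons c p)
  have "Gamma (a + 1 + 1) = (a + 1) * Gamma (a + 1)"
    using pCons.prems by (intro Gamma_plus1) (auto elim!: nonpos_Ints_cases)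
  then show ?case
    using pCons.IH[of "a + 1"] pCons.prems
    by (simp add: pderiv_pCons gamma_moment_add gamma_moment_pCons algebra_simps)
qed simp

text \<open>Lowering the index of the Laguerre polynomial by \<open>laguerre_poly_Suc\<close> and integrating by parts moves one
  derivative onto \<open>q\<close> and raises the parameter by one; iterating moves all of them. Hence every \<open>q\<close> of
  degree less than \<open>n\<close> is orthogonal to the polynomial.\<close>

lemma gamma_moment_mult_laguerre_poly:
  assumes "a > -1"
  shows "gamma_moment a (q * laguerre_poly n a) = (-1) ^ n / fact n * gamma_moment (a + real n) ((pderiv ^^ n) q)"
  using assms
proof (induction n arbitrary: a q)
  case (Suc n)
  let ?L = "laguerre_poly n (a + 1)"
  have "real (Suc n) * gamma_moment a (q * laguerre_poly (Suc n) a) =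
      gamma_moment a (q * smult (real (Suc n)) (laguerre_poly (Suc n) a))"
    by (simp add: gamma_moment_smult)
  also have "q * smult (real (Suc n)) (laguerre_poly (Suc n) a) =
      smult (a + 1) (q * ?L) + pCons 0 (pderiv (q * ?L) - q * ?L - pderiv q * ?L)"
    unfolding laguerre_poly_Suc by (simp add: pderiv_mult algebra_simps)
  also have "gamma_moment a \<dots> = - gamma_moment (a + 1) (pderiv q * ?L)"
    using Suc.prems
    by (simp add: gamma_moment_add gamma_moment_diff gamma_moment_smult gamma_moment_pCons gamma_moment_pderiv)
  also have "\<dots> = - ((-1) ^ n / fact n * gamma_moment (a + 1 + real n) ((pderiv ^^ Suc n) q))"
    using Suc.IH[of "a + 1" "pderiv q"] Suc.prems by (simp add: funpow_swap1)
  finally have "gamma_moment a (q * laguerre_poly (Suc n) a) =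
      - ((-1) ^ n / fact n * gamma_moment (a + 1 + real n) ((pderiv ^^ Suc n) q)) / real (Suc n)"
    by (subst eq_divide_eq) (simp add: mult.commute)
  then show ?case
    by (simp add: add_ac mult_ac del: funpow.simps)
qed simp

text \<open>For \<open>m \<le> n\<close> the \<open>n\<close>-th derivative moved onto \<open>laguerre_poly m a\<close> is 0 if \<open>m < n\<close> and, by the leading
  coefficient, the constant \<open>(-1) ^ n\<close> if \<open>m = n\<close>; symmetry covers \<open>m > n\<close>.\<close>

lemma laguerre_poly_orthogonal:
  assumes "a > -1"
  shows "gamma_moment a (laguerre_poly m a * laguerre_poly n a) =
      (if m = n then Gamma (a + real n + 1) / fact n else 0)"
proof -
  have *: "gamma_moment a (laguerre_poly m a * laguerre_poly n a) =
      (if m = n then Gamma (a + real n + 1) / fact n else 0)"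
    if "m \<le> n" for m n
  proof -
    have "(pderiv ^^ n) (laguerre_poly m a) = [:if m = n then (-1) ^ n else 0:]"
      by (rule poly_eqI)
         (use that in \<open>auto simp: coeff_higher_pderiv coeff_laguerre_poly coeff_pCons pochhammer_fact[symmetric]
           split: nat.splits\<close>)
    then show ?thesis
      using assms by (simp add: gamma_moment_mult_laguerre_poly gamma_moment_pCons power_mult_distrib[symmetric] add_ac)
  qed
  show ?thesis
    using *[of m n] *[of n m] by (cases "m \<le> n") (auto simp: mult.commute)
qed

lemma gamma_moment_laguerre_poly_dparam:
  assumes "a > -1"
  shows "gamma_moment a (laguerre_poly m a * laguerre_poly_dparam n a) =
    (if m < n then Gamma (a + real m + 1) / (fact m * (real n - real m)) else 0)"
proof -
  have "gamma_moment a (laguerre_poly m a * laguerre_poly_dparam n a) =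
    (\<Sum>i<n. if i = m then Gamma (a + real m + 1) / (fact m * (real n - real m)) else 0)"
    unfolding laguerre_poly_dparam_def sum_distrib_left gamma_moment_sum[OF assms]
    by (rule sum.cong) (auto simp: gamma_moment_smult laguerre_poly_orthogonal assms)
  then show ?thesis by simp
qed

section \<open>Koornwinder polynomials on the quadrant\<close>

lemma koornwinder_eq:
  "x > 0 \<Longrightarrow> y > 0 \<Longrightarrow> koornwinder n k a \<beta> x y =
    poly (laguerre_poly (n - k) (a + 2 * real k + 1)) x * x ^ k * poly (laguerre_poly k \<beta>) (y / x)"
  by (simp add: koornwinder_def laguerre_eq_poly)

lemma DERIV_koornwinder:
  assumes "x > 0" "y > 0"
  shows "((\<lambda>a. koornwinder n k a \<beta> x y) has_field_derivative
    poly (laguerre_poly_dparam (n - k) (\<alpha> + 2 * real k + 1)) x * x ^ k * poly (laguerre_poly k \<beta>) (y / x)) (at \<alpha>)"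
proof -
  have "((\<lambda>a. poly (laguerre_poly (n - k) (a + (2 * real k + 1))) x) has_field_derivative
      poly (laguerre_poly_dparam (n - k) (\<alpha> + (2 * real k + 1))) x) (at \<alpha>)"
    by (rule DERIV_shift[THEN iffD1, OF DERIV_laguerre_poly_parameter])
  from DERIV_cmult_right[OF DERIV_cmult_right[OF this]]
  show ?thesis using assms by (simp add: koornwinder_eq add_ac)
qed

text \<open>The substitution \<open>y = x u\<close> in the inner integral. Its Jacobian \<open>x\<close> turns the weight exponent \<open>\<alpha>\<close>
  of the first variable into \<open>\<alpha> + 1\<close>. Applied to the absolute value of the integrand, the same computation
  yields the integrability that Fubini's theorem asks for.\<close>

lemma ip_separated:
  assumes "\<alpha> > -2" "\<beta> > -1"
    and f: "\<And>x y. x > 0 \<Longrightarrow> y > 0 \<Longrightarrow> f x y * g x y = poly P x * poly Q (y / x)"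
  shows "ip_integrable \<alpha> \<beta> f g" "ip \<alpha> \<beta> f g = gamma_moment (\<alpha> + 1) P * gamma_moment \<beta> Q"
proof -
  define \<psi> where "\<psi> = (\<lambda>u. poly Q u * gamma_weight \<beta> u)"
  define F where "F = (\<lambda>z. poly P (fst z) * gamma_weight \<alpha> (fst z) * \<psi> (snd z / fst z))"
  have eq: "(\<lambda>z. indicat_real quadrant z *\<^sub>R (case z of (x, y) \<Rightarrow> f x y * g x y * weight \<alpha> \<beta> x y)) = F"
  proof
    fix z :: "real \<times> real"
    obtain x y where z: "z = (x, y)" by force
    show "indicat_real quadrant z *\<^sub>R (case z of (x, y) \<Rightarrow> f x y * g x y * weight \<alpha> \<beta> x y) = F z"
    proof (cases "x > 0 \<and> y > 0")
      case True
      then have "y powr \<beta> = x powr \<beta> * (y / x) powr \<beta>" by (simp add: powr_divide)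
      then have "weight \<alpha> \<beta> x y = (x powr \<alpha> * exp (- x)) * ((y / x) powr \<beta> * exp (- (y / x)))"
        using True by (simp add: weight_def powr_diff exp_add[symmetric])
      then show ?thesis
        using True by (simp add: z quadrant_def F_def \<psi>_def gamma_weight_def f)
    next
      case False
      then show ?thesis
        by (auto simp: z quadrant_def F_def \<psi>_def gamma_weight_def indicator_def zero_less_divide_iff)
    qed
  qed
  have \<psi>_int: "integrable lborel \<psi>"
    using integrable_poly_gamma_weight[OF assms(2)] by (simp add: \<psi>_def)
  have \<psi>_meas [measurable]: "\<psi> \<in> borel_measurable borel"
    using borel_measurable_integrable[OF \<psi>_int] by simp
  have P_meas [measurable]: "poly P \<in> borel_measurable borel"
    by (intro borel_measurable_continuous_onI continuous_intros)
  have inner: "(\<integral>y. h (y / x) \<partial>lborel) = x * (\<integral>u. h u \<partial>lborel)" if "x > 0" for x :: real and h :: "real \<Rightarrow> real"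
    using lborel_integral_real_affine[of x "\<lambda>y. h (y / x)" 0] that by simp
  have sect: "integrable lborel (\<lambda>y. \<psi> (y / x))" if "x > 0" for x
    using lborel_integrable_real_affine[OF \<psi>_int, of "1 / x" 0] that by simp
  have rescale: "gamma_weight \<alpha> x * c * (\<integral>y. h (y / x) \<partial>lborel) = c * gamma_weight (\<alpha> + 1) x * (\<integral>u. h u \<partial>lborel)"
    for x c :: real and h :: "real \<Rightarrow> real"
    by (cases "x > 0") (simp_all add: inner gamma_weight_mult[symmetric], simp_all add: gamma_weight_def)
  have "integrable (lborel \<Otimes>\<^sub>M lborel) F"
  proof (rule lborel_pair.Fubini_integrable)
    show "F \<in> borel_measurable (lborel \<Otimes>\<^sub>M lborel)"
      unfolding F_def by measurable
    have "(\<integral>y. norm (F (x, y)) \<partial>lborel) = norm (poly P x * gamma_weight (\<alpha> + 1) x) * (\<integral>u. norm (\<psi> u) \<partial>lborel)" for x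
      using rescale[of x "\<bar>poly P x\<bar>" "\<lambda>u. \<bar>\<psi> u\<bar>"]
      by (simp add: F_def abs_mult gamma_weight_def mult_ac)
    then show "integrable lborel (\<lambda>x. \<integral>y. norm (F (x, y)) \<partial>lborel)"
      using integrable_poly_gamma_weight[of "\<alpha> + 1" P] assms by (simp del: real_norm_def)
    show "AE x in lborel. integrable lborel (\<lambda>y. F (x, y))"
    proof (rule AE_I2)
      fix x show "integrable lborel (\<lambda>y. F (x, y))"
        by (cases "x > 0") (simp_all add: F_def sect, simp add: gamma_weight_def)
    qed
  qed
  note F_int = this
  have "integral\<^sup>L (lborel \<Otimes>\<^sub>M lborel) F = (\<integral>x. (\<integral>y. F (x, y) \<partial>lborel) \<partial>lborel)"
    by (rule lborel_pair.integral_fst'[OF F_int, symmetric])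
  also have "\<dots> = (\<integral>x. poly P x * gamma_weight (\<alpha> + 1) x * (\<integral>u. \<psi> u \<partial>lborel) \<partial>lborel)"
  proof (rule Bochner_Integration.integral_cong[OF refl])
    fix x show "(\<integral>y. F (x, y) \<partial>lborel) = poly P x * gamma_weight (\<alpha> + 1) x * (\<integral>u. \<psi> u \<partial>lborel)"
      using rescale[of x "poly P x" \<psi>] by (simp add: F_def mult_ac)
  qed
  also have "\<dots> = gamma_moment (\<alpha> + 1) P * gamma_moment \<beta> Q"
    by (simp add: gamma_moment_def \<psi>_def)
  finally show "ip \<alpha> \<beta> f g = gamma_moment (\<alpha> + 1) P * gamma_moment \<beta> Q"
    by (simp only: ip_def set_lebesgue_integral_def eq lborel_prod)
  show "ip_integrable \<alpha> \<beta> f g"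
    using F_int by (simp only: ip_integrable_def set_integrable_def eq lborel_prod)
qed

text \<open>The moment in \<open>y / x\<close> forces \<open>j = k\<close>. Then the factor \<open>x ^ (2 * k)\<close> is absorbed into the weight,
  whose exponent becomes the common parameter of the two polynomials in \<open>x\<close>.\<close>

lemma ip_koornwinder_dalpha:
  assumes "\<alpha> > -2" "\<beta> > -1" "j \<le> m" "k \<le> n"
  shows "ip_integrable \<alpha> \<beta> (koornwinder m j \<alpha> \<beta>) (koornwinder_dalpha n k \<alpha> \<beta>)" (is ?I)
    and "ip \<alpha> \<beta> (koornwinder m j \<alpha> \<beta>) (koornwinder_dalpha n k \<alpha> \<beta>) =
      (if k = j \<and> m < n then H_coeff n k m \<alpha> \<beta> else 0)" (is ?E)
proof -
  define P where "P = monom 1 (j + k) *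
    (laguerre_poly (m - j) (\<alpha> + 2 * real j + 1) * laguerre_poly_dparam (n - k) (\<alpha> + 2 * real k + 1))"
  have fg: "koornwinder m j \<alpha> \<beta> x y * koornwinder_dalpha n k \<alpha> \<beta> x y =
      poly P x * poly (laguerre_poly j \<beta> * laguerre_poly k \<beta>) (y / x)" if "x > 0" "y > 0" for x y
    using DERIV_koornwinder[OF that] that
    by (simp add: koornwinder_dalpha_def DERIV_imp_deriv koornwinder_eq P_def poly_monom power_add mult_ac)
  show ?I
    by (rule ip_separated(1)[OF assms(1,2)]) (rule fg)
  have separated: "ip \<alpha> \<beta> (koornwinder m j \<alpha> \<beta>) (koornwinder_dalpha n k \<alpha> \<beta>) =
      gamma_moment (\<alpha> + 1) P * gamma_moment \<beta> (laguerre_poly j \<beta> * laguerre_poly k \<beta>)"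
    by (rule ip_separated(2)[OF assms(1,2)]) (rule fg)
  show ?E
  proof (cases "k = j")
    case True
    have shift: "m - k < n - k \<longleftrightarrow> m < n" "real (n - k) - real (m - k) = real n - real m"
      "\<alpha> + 2 * real k + 1 + real (m - k) + 1 = \<alpha> + real m + real k + 2"
      using assms True by (auto simp: of_nat_diff)
    have "gamma_moment (\<alpha> + 1) P = gamma_moment (\<alpha> + 2 * real k + 1)
        (laguerre_poly (m - k) (\<alpha> + 2 * real k + 1) * laguerre_poly_dparam (n - k) (\<alpha> + 2 * real k + 1))"
      using assms True by (simp add: P_def gamma_moment_monom_mult add_ac)
    also have "\<dots> =
        (if m < n then Gamma (\<alpha> + real m + real k + 2) / (fact (m - k) * (real n - real m)) else 0)"
      using gamma_moment_laguerre_poly_dparam[of "\<alpha> + 2 * real k + 1" "m - k" "n - k"] assms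
      unfolding shift by simp
    finally show ?thesis
      unfolding separated using assms True
      by (simp add: laguerre_poly_orthogonal H_coeff_def t_coeff_def mult_ac)
  next
    case False
    then show ?thesis
      unfolding separated using assms by (simp add: laguerre_poly_orthogonal)
  qed
qed

theorem theorem8:
  fixes \<alpha> \<beta> :: real and n m k j :: nat
  assumes "\<alpha> > -1" and "\<beta> > -1" and "\<alpha> - \<beta> > -1" and "j \<le> m"
  shows
    "(k \<le> n \<longrightarrow>
        (\<forall>x>0. \<forall>y>0. (\<lambda>a. koornwinder n k a \<beta> x y) field_differentiable (at \<alpha>)) \<and>
        ip_integrable \<alpha> \<beta> (koornwinder m j \<alpha> \<beta>) (koornwinder_dalpha n k \<alpha> \<beta>)) \<and>
     (n \<ge> k + 1 \<longrightarrow>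
        (k \<noteq> j \<longrightarrow> ip \<alpha> \<beta> (koornwinder m j \<alpha> \<beta>) (koornwinder_dalpha n k \<alpha> \<beta>) = 0) \<and>
        (k = j \<and> m \<ge> n \<longrightarrow> ip \<alpha> \<beta> (koornwinder m j \<alpha> \<beta>) (koornwinder_dalpha n k \<alpha> \<beta>) = 0) \<and>
        (n > m \<and> m \<ge> k \<and> k = j \<longrightarrow>
           ip \<alpha> \<beta> (koornwinder m j \<alpha> \<beta>) (koornwinder_dalpha n k \<alpha> \<beta>) = H_coeff n k m \<alpha> \<beta>)) \<and>
     (n = k \<longrightarrow> ip \<alpha> \<beta> (koornwinder m j \<alpha> \<beta>) (koornwinder_dalpha n n \<alpha> \<beta>) = 0)"
proof -
  have "\<alpha> > -2"
    using assms(1) by simp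
  note ip = ip_koornwinder_dalpha[OF this assms(2,4)]
  have "(\<lambda>a. koornwinder n k a \<beta> x y) field_differentiable (at \<alpha>)" if "x > 0" "y > 0" for x y
    unfolding field_differentiable_def using DERIV_koornwinder[OF that] by blast
  then show ?thesis
    using assms(4) by (auto simp: ip)
qed

end
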